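(* Let $H$ be a finite graph and let $\mu(H)$ be as defined in the context. Let $G_1,\ldots,G_m$ be finite connected graphs none of which contains $H$ as a minor, let $\Gamma=G_1\square\cdots\square G_m$, and let $G$ be a subgraph of $\Gamma$ with at least one vertex. Then $$\frac{|E(G)|}{|V(G)|}\le \mu(H)\cdot \mathrm{vcd}^*(G)\le \mu(H)\cdot\log|V(G)|,$$ where $\mathrm{vcd}^*(G)$ is computed with respect to $\Gamma$.
   Context: All graphs are finite, simple, undirected; $\log$ is base 2. The Cartesian product $G_1\square\cdots\square G_m$ has vertex set $V(G_1)\times\cdots\times V(G_m)$, two tuples being adjacent iff they differ in exactly one coordinate $j$ and their $j$-th coordinates are adjacent in $G_j$. $\mathcal G(H)$ is the class of finite graphs not having $H$ as a minor; $\mu(H)$ is a constant such that every graph in $\mathcal G(H)$ has average degree $2|E|/|V|$ at most $\mu(H)$. Minor-subproducts: for each $i$, let $\mathcal P_i=\{P^i_1,\ldots,P^i_{t_i}\}$ be a partition of $V(G_i)$ into sets each inducing a connected subgraph of $G_i$, and let $M_i$ be a graph with vertex set $\mathcal P_i$ such that whenever two parts are adjacent in $M_i$ some edge of $G_i$ joins them (so $M_i$ is a minor of $G_i$). Then $M=M_1\square\cdots\square M_m$ is a minor-subproduct of $\Gamma$; it is shattered by $G$ if every set $P^1_{l_1}\times\cdots\times P^m_{l_m}$ ($1\le l_j\le t_j$) contains a vertex of $G$. A factor is non-trivial if it has at least two vertices. The minor VC-dimension $\mathrm{vcd}^*(G)$ of $G$ with respect to $\Gamma$ is the largest number of non-trivial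 factors of a minor-subproduct of $\Gamma$ shattered by $G$. *)

theory Defs
  imports Complex_Main "HOL-Library.FuncSet" "HOL-Library.Disjoint_Sets"
    "Graph_Theory.Graph_Theory"
begin

text \<open>
  Finite simple undirected graphs are represented by \<^const>\<open>pair_graph\<close>: a finite vertex set
  with a symmetric, irreflexive adjacency relation \<^const>\<open>parcs\<close>.  Every undirected edge
  contributes two arcs to \<^const>\<open>parcs\<close>, so edges are counted through the following set.
\<close>

definition uedges :: "'a pair_pre_digraph \<Rightarrow> 'a set set" where
  "uedges G = (\<lambda>(u, v). {u, v}) ` parcs G"

definition connected_graph :: "'a pair_pre_digraph \<Rightarrow> bool" where
  "connected_graph G \<longleftrightarrow> Digraph_Component.connected (with_proj G)"

text \<open>\<^const>\<open>Digraph_Component.connected\<close> demands a non-empty vertex set.\<close>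

definition connected_part :: "'a pair_pre_digraph \<Rightarrow> 'a set \<Rightarrow> bool" where
  "connected_part G A \<longleftrightarrow> A \<subseteq> pverts G \<and> Digraph_Component.connected (with_proj G \<restriction> A)"

text \<open>
  \<open>H\<close> arises from a subgraph of \<open>G\<close> by contracting edges; \<open>\<beta> x\<close> is the connected set contracted
  to the vertex \<open>x\<close>.
\<close>

definition is_minor :: "'b pair_pre_digraph \<Rightarrow> 'a pair_pre_digraph \<Rightarrow> bool" where
  "is_minor H G \<longleftrightarrow> (\<exists>\<beta>.
     (\<forall>x\<in>pverts H. connected_part G (\<beta> x)) \<and>
     disjoint_family_on \<beta> (pverts H) \<and>
     (\<forall>(x, y)\<in>parcs H. \<exists>u\<in>\<beta> x. \<exists>v\<in>\<beta> y. (u, v) \<in> parcs G))"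

definition avg_degree :: "'a pair_pre_digraph \<Rightarrow> real" where
  "avg_degree G = 2 * real (card (uedges G)) / real (card (pverts G))"

text \<open>
  Every finite graph is isomorphic to one with vertices in \<^typ>\<open>nat\<close>, so quantifying over these
  covers the whole class of finite graphs without \<open>H\<close> as a minor.
\<close>

definition bounds_avg_degree :: "'b pair_pre_digraph \<Rightarrow> real \<Rightarrow> bool" where
  "bounds_avg_degree H \<mu> \<longleftrightarrow> (\<forall>G :: nat pair_pre_digraph.
     pair_graph G \<and> pverts G \<noteq> {} \<and> \<not> is_minor H G \<longrightarrow> avg_degree G \<le> \<mu>)"

definition cart_prod :: "nat \<Rightarrow> (nat \<Rightarrow> 'a pair_pre_digraph) \<Rightarrow> (nat \<Rightarrow> 'a) pair_pre_digraph" where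
  "cart_prod m Gs =
     \<lparr> pverts = (\<Pi>\<^sub>E i\<in>{..<m}. pverts (Gs i)),
       parcs = {(x, y). x \<in> (\<Pi>\<^sub>E i\<in>{..<m}. pverts (Gs i)) \<and> y \<in> (\<Pi>\<^sub>E i\<in>{..<m}. pverts (Gs i)) \<and>
         (\<exists>j<m. x j \<noteq> y j \<and> (x j, y j) \<in> parcs (Gs j) \<and> (\<forall>i<m. i \<noteq> j \<longrightarrow> x i = y i))} \<rparr>"

text \<open>
  The minor-subproduct itself is \<open>cart_prod m Ms\<close>; we keep its family of factors \<open>Ms\<close>.  The
  vertices of \<open>Ms i\<close> are the parts of the partition of the vertex set of \<open>Gs i\<close>.
\<close>

definition minor_subproduct ::
    "nat \<Rightarrow> (nat \<Rightarrow> 'a pair_pre_digraph) \<Rightarrow> (nat \<Rightarrow> 'a set pair_pre_digraph) \<Rightarrow> bool" where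
  "minor_subproduct m Gs Ms \<longleftrightarrow> (\<forall>i<m.
     pair_graph (Ms i) \<and>
     partition_on (pverts (Gs i)) (pverts (Ms i)) \<and>
     (\<forall>A\<in>pverts (Ms i). connected_part (Gs i) A) \<and>
     (\<forall>(A, B)\<in>parcs (Ms i). \<exists>u\<in>A. \<exists>v\<in>B. (u, v) \<in> parcs (Gs i)))"

definition shattered_by ::
    "nat \<Rightarrow> (nat \<Rightarrow> 'a set pair_pre_digraph) \<Rightarrow> (nat \<Rightarrow> 'a) pair_pre_digraph \<Rightarrow> bool" where
  "shattered_by m Ms G \<longleftrightarrow>
     (\<forall>P\<in>pverts (cart_prod m Ms). (\<Pi>\<^sub>E i\<in>{..<m}. P i) \<inter> pverts G \<noteq> {})"

definition nontrivial_factors :: "nat \<Rightarrow> (nat \<Rightarrow> 'a pair_pre_digraph) \<Rightarrow> nat set" where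
  "nontrivial_factors m Ms = {i. i < m \<and> 2 \<le> card (pverts (Ms i))}"

text \<open>
  The set below is bounded by \<open>m\<close>; for connected factors and non-empty \<open>G\<close> it contains \<open>0\<close>
  (take all partitions with a single part), so the maximum exists.
\<close>

definition vcd_star ::
    "nat \<Rightarrow> (nat \<Rightarrow> 'a pair_pre_digraph) \<Rightarrow> (nat \<Rightarrow> 'a) pair_pre_digraph \<Rightarrow> nat" where
  "vcd_star m Gs G =
     Max {card (nontrivial_factors m Ms) | Ms. minor_subproduct m Gs Ms \<and> shattered_by m Ms G}"

end

theory Submission
  imports Defs
begin

text \<open>
  Induction on the number of factors, bounding the number of arcs induced on a vertex set \<open>V\<close> of
  the product by \<open>2 \<mu> d |V|\<close>, where \<open>d\<close> bounds the minor VC-dimension of \<open>V\<close>.  Let \<open>U\<close> be the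
  projection of \<open>V\<close> that forgets the last coordinate.  Arcs in the last direction lie in fibres,
  each an induced subgraph of a minor-free graph, and contribute at most \<open>2 \<mu> (|V| - |U|)\<close>.  The
  remaining arcs lie in the slices \<open>V\<^sub>u\<close>; these are merged into \<open>U\<close> along a growing connected set
  \<open>S\<close> of values \<open>u\<close>.  Induced arc counts are supermodular, so every merging step loses at most the
  arcs of the overlap of \<open>V\<^sub>w\<close> with the slices already merged.  Such an overlap has dimension at
  most \<open>d - 1\<close>: extending \<open>S\<close> and \<open>{w}\<close> to a partition of the last factor into two connected parts
  adds a non-trivial factor to everything that the overlap shatters.  The overlaps have total size
  \<open>|V| - |U|\<close>, and the three contributions add up to \<open>2 \<mu> d |V|\<close>.  The logarithmic bound holds
  because the parts of a shattered minor-subproduct contain distinct vertices.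
\<close>

section \<open>Finite simple graphs: arcs, edges and their basic properties\<close>

lemma pair_graph_sym: "pair_graph G \<Longrightarrow> (u, v) \<in> parcs G \<Longrightarrow> (v, u) \<in> parcs G"
  by (meson pair_graph.axioms(2) pair_pseudo_graph.axioms(2) pair_sym_digraph.arcs_symmetric)

lemma pair_graph_in_verts:
  assumes "pair_graph G" "(u, v) \<in> parcs G"
  shows "u \<in> pverts G" "v \<in> pverts G"
proof -
  interpret pair_graph G by fact
  show "u \<in> pverts G" "v \<in> pverts G"
    using assms(2) by (rule in_arcsD1, rule in_arcsD2)
qed

lemma pair_graph_finite:
  assumes "pair_graph G"
  shows "finite (pverts G)" "finite (parcs G)"
proof -
  interpret pair_graph G by fact
  show "finite (pverts G)" "finite (parcs G)"
    by (rule pair_finite_verts, rule pair_finite_arcs)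
qed

lemma pair_graph_irrefl: "pair_graph G \<Longrightarrow> (v, v) \<notin> parcs G"
  by (metis fst_conv pair_digraph.axioms(2) pair_graph.axioms(1)
      pair_loopfree_digraph.pair_no_loops snd_conv)

lemma pair_graphI:
  assumes "finite (pverts G)" "parcs G \<subseteq> pverts G \<times> pverts G"
    and "\<And>u v. (u, v) \<in> parcs G \<Longrightarrow> (v, u) \<in> parcs G"
    and "\<And>v. (v, v) \<notin> parcs G"
  shows "pair_graph G"
proof -
  have "finite (parcs G)"
    using assms(1,2) finite_subset by blast
  then show ?thesis
    using assms by unfold_locales (auto simp: symmetric_def intro!: symI)
qed

text \<open>By symmetry an edge comes with both orientations, and by irreflexivity these are
  distinct, so each fibre of the map from arcs to edges has two elements.\<close>

lemma card_parcs_eq: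
  assumes "pair_graph G"
  shows "card (parcs G) = 2 * card (uedges G)"
proof -
  let ?f = "\<lambda>(u, v). {u, v}"
  have two: "card {a \<in> parcs G. ?f a = e} = 2" if "e \<in> uedges G" for e
  proof -
    obtain u v where e: "e = {u, v}" "(u, v) \<in> parcs G"
      using \<open>e \<in> uedges G\<close> unfolding uedges_def by force
    have "{a \<in> parcs G. ?f a = e} = {(u, v), (v, u)}"
      using e pair_graph_sym[OF assms] by (auto simp: doubleton_eq_iff)
    moreover have "u \<noteq> v"
      using e pair_graph_irrefl[OF assms] by auto
    ultimately show ?thesis by simp
  qed
  have "card (parcs G) = (\<Sum>e\<in>uedges G. card {a \<in> parcs G. ?f a = e})"
    using sum.image_gen[of "parcs G" "\<lambda>_. 1::nat" ?f] pair_graph_finite[OF assms]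
    unfolding uedges_def by simp
  then show ?thesis using two by simp
qed

section \<open>Connected parts\<close>

text \<open>Reachability is traded for the existence of an arc across every proper cut, the form
  that suits growing connected sets. A set with no leaving arc contains everything reachable from
  it; conversely, the set of vertices reachable from \<open>u\<close> has no leaving arc.\<close>

lemma connected_part_iff_cut:
  assumes G: "pair_graph G"
  shows "connected_part G A \<longleftrightarrow> A \<subseteq> pverts G \<and> A \<noteq> {} \<and>
    (\<forall>B. B \<subseteq> A \<and> B \<noteq> {} \<and> B \<noteq> A \<longrightarrow> (\<exists>u\<in>B. \<exists>v\<in>A - B. (u, v) \<in> parcs G))"
proof -
  let ?E = "parcs G \<inter> A \<times> A"
  \<comment> \<open>\<open>connected\<close> refers to the symmetric closure; the arcs of
    \<open>G\<close> are symmetric already, so the closure adds nothing.\<close>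
  have E: "parcs (mk_symmetric (with_proj G \<restriction> A)) = ?E"
    using pair_graph_sym[OF G] by (fastforce simp: parcs_mk_symmetric induce_subgraph_def)
  have reach: "Digraph_Component.connected (with_proj G \<restriction> A) \<longleftrightarrow>
      A \<noteq> {} \<and> (\<forall>u\<in>A. \<forall>v\<in>A. (u, v) \<in> rtrancl_on A ?E)"
    by (simp add: connected_def strongly_connected_def reachable_def E)
  have "(\<forall>u\<in>A. \<forall>v\<in>A. (u, v) \<in> rtrancl_on A ?E) \<longleftrightarrow>
    (\<forall>B. B \<subseteq> A \<and> B \<noteq> {} \<and> B \<noteq> A \<longrightarrow> (\<exists>u\<in>B. \<exists>v\<in>A - B. (u, v) \<in> parcs G))"
  proof (intro iffI allI ballI impI)
    fix B assume conn: "\<forall>u\<in>A. \<forall>v\<in>A. (u, v) \<in> rtrancl_on A ?E" and B: "B \<subseteq> A \<and> B \<noteq> {} \<and> B \<noteq> A"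
    then obtain u v where uv: "u \<in> B" "v \<in> A - B" by blast
    show "\<exists>u\<in>B. \<exists>v\<in>A - B. (u, v) \<in> parcs G"
    proof (rule ccontr)
      assume no: "\<not> ?thesis"
      have "(u, v) \<in> rtrancl_on A ?E" using conn uv B by blast
      then have "v \<in> B"
        by (induct rule: rtrancl_on_induct) (use uv no in auto)
      then show False using uv by blast
    qed
  next
    fix u v
    assume cut: "\<forall>B. B \<subseteq> A \<and> B \<noteq> {} \<and> B \<noteq> A \<longrightarrow> (\<exists>u\<in>B. \<exists>v\<in>A - B. (u, v) \<in> parcs G)"
      and uv: "u \<in> A" "v \<in> A"
    define B where "B = {w. (u, w) \<in> rtrancl_on A ?E}"
    have "B \<subseteq> A" "u \<in> B"
      using uv in_rtrancl_on_in_F by (auto simp: B_def dest: in_rtrancl_on_in_F)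
    moreover have "\<not> (\<exists>u\<in>B. \<exists>v\<in>A - B. (u, v) \<in> parcs G)"
    proof
      assume "\<exists>u\<in>B. \<exists>v\<in>A - B. (u, v) \<in> parcs G"
      then obtain x y where xy: "x \<in> B" "y \<in> A - B" "(x, y) \<in> parcs G" by blast
      then have "(u, y) \<in> rtrancl_on A ?E"
        using \<open>B \<subseteq> A\<close> by (auto simp: B_def intro: rtrancl_on_into_rtrancl_on)
      then show False using xy by (simp add: B_def)
    qed
    ultimately have "B = A" using cut by blast
    then show "(u, v) \<in> rtrancl_on A ?E" using uv by (auto simp: B_def)
  qed
  then show ?thesis unfolding connected_part_def reach by blast
qed

lemma connected_part_verts:
  assumes "pair_graph G" "connected_graph G"
  shows "connected_part G (pverts G)"
proof -
  have "with_proj G \<restriction> pverts G = with_proj G"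
    using pair_graph_in_verts[OF assms(1)] by (auto simp: induce_subgraph_def with_proj_def)
  then show ?thesis using assms(2) by (simp add: connected_part_def connected_graph_def)
qed

lemma connected_part_singleton:
  "pair_graph G \<Longrightarrow> v \<in> pverts G \<Longrightarrow> connected_part G {v}"
  by (auto simp: connected_part_iff_cut)

text \<open>A proper cut of \<open>insert w A\<close> either restricts to a proper cut of
  \<open>A\<close> or separates \<open>w\<close> from \<open>A\<close>, and then the arc from
  \<open>a\<close> to \<open>w\<close>, or its reverse, crosses it.\<close>

lemma connected_part_insert:
  assumes G: "pair_graph G" and A: "connected_part G A" and e: "(a, w) \<in> parcs G" "a \<in> A"
  shows "connected_part G (insert w A)"
  unfolding connected_part_iff_cut[OF G]
proof (intro conjI allI impI)
  have A': "A \<subseteq> pverts G"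
    and cut: "\<And>B. B \<subseteq> A \<Longrightarrow> B \<noteq> {} \<Longrightarrow> B \<noteq> A \<Longrightarrow> \<exists>u\<in>B. \<exists>v\<in>A - B. (u, v) \<in> parcs G"
    using A by (auto simp: connected_part_iff_cut[OF G])
  show "insert w A \<subseteq> pverts G"
    using A' pair_graph_in_verts[OF G e(1)] by auto
  fix B assume B: "B \<subseteq> insert w A \<and> B \<noteq> {} \<and> B \<noteq> insert w A"
  show "\<exists>u\<in>B. \<exists>v\<in>insert w A - B. (u, v) \<in> parcs G"
  proof (cases "w \<in> A \<or> (B \<inter> A \<noteq> {} \<and> B \<inter> A \<noteq> A)")
    case True
    then have "\<exists>u\<in>B \<inter> A. \<exists>v\<in>A - B \<inter> A. (u, v) \<in> parcs G"
      using B by (intro cut) auto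
    then show ?thesis by blast
  next
    case False
    then consider "B = {w}" "w \<notin> A" | "B = A" "w \<notin> A" using B by blast
    then show ?thesis using e pair_graph_sym[OF G e(1)] by cases auto
  qed
qed simp

lemma connected_part_leaving_arc:
  assumes "pair_graph G" "connected_part G (pverts G)" "B \<subseteq> pverts G" "B \<noteq> {}" "B \<noteq> pverts G"
  obtains u v where "u \<in> B" "v \<in> pverts G - B" "(u, v) \<in> parcs G"
  using assms unfolding connected_part_iff_cut[OF assms(1)] by blast

text \<open>The whole graph is reached from one vertex through connected sets: a largest connected
  set satisfying \<open>P\<close> has no leaving arc, since the head of such an arc could be
  inserted.\<close>

lemma connected_part_induct [consumes 2, case_names singleton insert]:
  assumes G: "pair_graph G" and conn: "connected_part G (pverts G)"
    and singleton: "\<And>v. v \<in> pverts G \<Longrightarrow> P {v}"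
    and insert: "\<And>S w. connected_part G S \<Longrightarrow> w \<in> pverts G - S \<Longrightarrow> P S \<Longrightarrow> P (insert w S)"
  shows "P (pverts G)"
proof -
  let ?Q = "\<lambda>S. connected_part G S \<and> P S"
  obtain v where v: "v \<in> pverts G" using conn by (auto simp: connected_part_iff_cut[OF G])
  have fin: "finite (pverts G)" by (rule pair_graph_finite[OF G])
  have "?Q {v}" using v singleton connected_part_singleton[OF G] by blast
  moreover have "\<forall>S. ?Q S \<longrightarrow> card S < Suc (card (pverts G))"
    using fin by (auto simp: connected_part_def less_Suc_eq_le intro: card_mono)
  ultimately obtain S where S: "?Q S" and max: "\<And>T. ?Q T \<Longrightarrow> card T \<le> card S"
    using ex_has_greatest_nat[of ?Q "{v}" card "Suc (card (pverts G))"] by blast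
  have sub: "S \<subseteq> pverts G" "S \<noteq> {}" using S by (auto simp: connected_part_iff_cut[OF G])
  have "S = pverts G"
  proof (rule ccontr)
    assume "S \<noteq> pverts G"
    then obtain u w where uw: "u \<in> S" "w \<in> pverts G - S" "(u, w) \<in> parcs G"
      using connected_part_leaving_arc[OF G conn sub] by blast
    then have "?Q (insert w S)" using S insert connected_part_insert[OF G] by blast
    from max[OF this] show False using uw finite_subset[OF sub(1) fin] by simp
  qed
  then show ?thesis using S by blast
qed

text \<open>Among disjoint connected pairs extending \<open>(S, T)\<close>, take one with largest
  union. If it missed a vertex, some arc would leave the union, and its head could be absorbed into
  the side containing its tail.\<close>

lemma connected_bipartition:
  assumes G: "pair_graph G" and conn: "connected_part G (pverts G)"
    and S: "connected_part G S" and T: "connected_part G T" and disj: "S \<inter> T = {}"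
  obtains A B where "connected_part G A" "connected_part G B" "S \<subseteq> A" "T \<subseteq> B"
    "A \<inter> B = {}" "A \<union> B = pverts G"
proof -
  define Q where "Q = (\<lambda>(A, B). connected_part G A \<and> connected_part G B \<and>
    S \<subseteq> A \<and> T \<subseteq> B \<and> A \<inter> B = {})"
  have fin: "finite (pverts G)" by (rule pair_graph_finite[OF G])
  have "Q (S, T)" using S T disj by (simp add: Q_def)
  moreover have "\<forall>p. Q p \<longrightarrow> card (fst p \<union> snd p) < Suc (card (pverts G))"
    using fin by (auto simp: Q_def connected_part_def less_Suc_eq_le intro!: card_mono)
  ultimately obtain p where p: "Q p"
    and max: "\<And>q. Q q \<Longrightarrow> card (fst q \<union> snd q) \<le> card (fst p \<union> snd p)"
    using ex_has_greatest_nat[of Q "(S, T)" "\<lambda>p. card (fst p \<union> snd p)"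
        "Suc (card (pverts G))"] by blast
  obtain A B where AB: "p = (A, B)" by fastforce
  have AB_props: "connected_part G A" "connected_part G B" "S \<subseteq> A" "T \<subseteq> B" "A \<inter> B = {}"
    using p AB by (auto simp: Q_def)
  have sub: "A \<union> B \<subseteq> pverts G" "A \<union> B \<noteq> {}"
    using AB_props by (auto simp: connected_part_iff_cut[OF G])
  have "A \<union> B = pverts G"
  proof (rule ccontr)
    assume "A \<union> B \<noteq> pverts G"
    then obtain u w where uw: "u \<in> A \<union> B" "w \<in> pverts G - (A \<union> B)" "(u, w) \<in> parcs G"
      using connected_part_leaving_arc[OF G conn sub] by blast
    have "Q (insert w A, B) \<or> Q (A, insert w B)"
      using AB_props uw connected_part_insert[OF G _ uw(3)] by (auto simp: Q_def)
    then have "card (insert w (A \<union> B)) \<le> card (A \<union> B)"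
      using max[of "(insert w A, B)"] max[of "(A, insert w B)"] AB by auto
    then show False using uw finite_subset[OF sub(1) fin] by simp
  qed
  then show ?thesis using that AB_props by blast
qed

section \<open>Arcs induced in a minor-free graph\<close>

text \<open>The degree bound speaks about graphs on \<open>nat\<close>, so the subgraph induced on
  \<open>W\<close> is copied there along an injection. A minor of the copy is a minor of
  \<open>K\<close>.\<close>

lemma induced_arcs_le_of_minor_free:
  fixes K :: "'a pair_pre_digraph"
  assumes bound: "bounds_avg_degree H \<mu>" and K: "pair_graph K" and free: "\<not> is_minor H K"
    and W: "W \<subseteq> pverts K"
  shows "real (card (parcs K \<inter> W \<times> W)) \<le> \<mu> * real (card W)"
proof (cases "W = {}")
  case False
  have fin: "finite W" using W pair_graph_finite[OF K] finite_subset by blast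
  then obtain f :: "'a \<Rightarrow> nat" where f: "inj_on f W"
    using finite_imp_inj_to_nat_seg by metis
  let ?E = "parcs K \<inter> W \<times> W"
  define G where "G = \<lparr>pverts = f ` W, parcs = map_prod f f ` ?E\<rparr>"
  have arc: "(f u, f v) \<in> parcs G \<longleftrightarrow> (u, v) \<in> parcs K" if "u \<in> W" "v \<in> W" for u v
  proof
    assume "(f u, f v) \<in> parcs G"
    then obtain a b where ab: "(a, b) \<in> ?E" "f u = f a" "f v = f b" by (auto simp: G_def)
    then have "u = a" "v = b" using f that by (auto dest: inj_onD)
    then show "(u, v) \<in> parcs K" using ab by simp
  qed (use that in \<open>auto simp: G_def\<close>)
  have G: "pair_graph G"
  proof (rule pair_graphI)
    show "finite (pverts G)" "parcs G \<subseteq> pverts G \<times> pverts G"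
      using fin by (auto simp: G_def)
    show "(y, x) \<in> parcs G" if "(x, y) \<in> parcs G" for x y
      using that arc pair_graph_sym[OF K] by (fastforce simp: G_def)
    show "(x, x) \<notin> parcs G" for x
    proof
      assume "(x, x) \<in> parcs G"
      then obtain a b where ab: "(a, b) \<in> ?E" "x = f a" "x = f b" by (auto simp: G_def)
      then have "a = b" using f by (auto dest: inj_onD)
      then show False using ab pair_graph_irrefl[OF K] by simp
    qed
  qed
  have "\<not> is_minor H G"
  proof
    assume "is_minor H G"
    then obtain \<beta> where \<beta>: "\<And>x. x \<in> pverts H \<Longrightarrow> connected_part G (\<beta> x)"
      "disjoint_family_on \<beta> (pverts H)"
      "\<And>x y. (x, y) \<in> parcs H \<Longrightarrow> \<exists>u\<in>\<beta> x. \<exists>v\<in>\<beta> y. (u, v) \<in> parcs G"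
      unfolding is_minor_def by blast
    \<comment> \<open>Branch sets of the minor in the copy are pulled back along \<open>f\<close>;
      arcs and cuts correspond because \<open>f\<close> is injective on \<open>W\<close>.\<close>
    define \<gamma> where "\<gamma> = (\<lambda>x. {w \<in> W. f w \<in> \<beta> x})"
    have "connected_part K (\<gamma> x)" if "x \<in> pverts H" for x
      unfolding connected_part_iff_cut[OF K]
    proof (intro conjI allI impI)
      have b': "\<beta> x \<subseteq> pverts G" "\<beta> x \<noteq> {}"
        and cut: "\<And>B. B \<subseteq> \<beta> x \<Longrightarrow> B \<noteq> {} \<Longrightarrow> B \<noteq> \<beta> x \<Longrightarrow>
            \<exists>u\<in>B. \<exists>v\<in>\<beta> x - B. (u, v) \<in> parcs G"
        using \<beta>(1)[OF that] unfolding connected_part_iff_cut[OF G] by blast+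
      have b: "\<beta> x \<subseteq> f ` W" "\<beta> x \<noteq> {}" using b' by (simp_all add: G_def)
      show "\<gamma> x \<subseteq> pverts K" using W by (auto simp: \<gamma>_def)
      show "\<gamma> x \<noteq> {}" using b by (auto simp: \<gamma>_def)
      fix B assume B: "B \<subseteq> \<gamma> x \<and> B \<noteq> {} \<and> B \<noteq> \<gamma> x"
      then obtain w where "w \<in> \<gamma> x" "w \<notin> B" by blast
      then have "f w \<in> \<beta> x" "f w \<notin> f ` B"
        using f B by (auto simp: \<gamma>_def dest: inj_onD)
      then have "\<exists>u\<in>f ` B. \<exists>v\<in>\<beta> x - f ` B. (u, v) \<in> parcs G"
        using B by (intro cut) (auto simp: \<gamma>_def)
      then obtain u y where u: "u \<in> B" "y \<in> \<beta> x - f ` B" "(f u, y) \<in> parcs G" by blast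
      obtain v where v: "v \<in> W" "y = f v" using b u by blast
      have "v \<in> \<gamma> x - B" using u(2) v by (auto simp: \<gamma>_def)
      moreover have "(u, v) \<in> parcs K" using arc[of u v] u v B by (auto simp: \<gamma>_def)
      ultimately show "\<exists>u\<in>B. \<exists>v\<in>\<gamma> x - B. (u, v) \<in> parcs K" using u(1) by blast
    qed
    moreover have "disjoint_family_on \<gamma> (pverts H)"
      using \<beta>(2) by (fastforce simp: disjoint_family_on_def \<gamma>_def)
    moreover have "\<exists>u\<in>\<gamma> x. \<exists>v\<in>\<gamma> y. (u, v) \<in> parcs K" if "(x, y) \<in> parcs H" for x y
      using \<beta>(3)[OF that] by (fastforce simp: \<gamma>_def G_def)
    ultimately have "is_minor H K"
      unfolding is_minor_def by (intro exI[of _ \<gamma>]) auto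
    then show False using free by simp
  qed
  then have "avg_degree G \<le> \<mu>"
    using bound G False by (auto simp: bounds_avg_degree_def G_def)
  moreover have "card (parcs G) = card ?E"
  proof -
    have "inj_on (map_prod f f) ?E"
      using map_prod_inj_on[OF f f] by (rule inj_on_subset) auto
    then show ?thesis by (simp add: G_def card_image)
  qed
  moreover have "card (pverts G) = card W"
    using f by (simp add: G_def card_image)
  moreover have "card W > 0" using False fin by (simp add: card_gt_0_iff)
  \<comment> \<open>Average degree equals arcs per vertex, as every edge counts for two
    arcs.\<close>
  ultimately show ?thesis
    using card_parcs_eq[OF G] by (simp add: avg_degree_def divide_simps)
qed simp

section \<open>Merging slices\<close>

text \<open>Arcs inside both sets are exactly those inside the intersection. The union may gain
  further arcs, between \<open>A - B\<close> and \<open>B - A\<close>, hence only an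
  inequality.\<close>

lemma card_induced_supermodular:
  assumes "finite A" "finite B"
  shows "card (R \<inter> A \<times> A) + card (R \<inter> B \<times> B)
    \<le> card (R \<inter> (A \<union> B) \<times> (A \<union> B)) + card (R \<inter> (A \<inter> B) \<times> (A \<inter> B))"
proof -
  let ?a = "\<lambda>X. R \<inter> X \<times> X"
  have fin: "finite (?a A)" "finite (?a B)" "finite (?a (A \<union> B))"
    using assms by auto
  have "card (?a A) + card (?a B) = card (?a A \<union> ?a B) + card (?a A \<inter> ?a B)"
    by (rule card_Un_Int[OF fin(1,2)])
  also have "?a A \<inter> ?a B = ?a (A \<inter> B)" by blast
  also have "card (?a A \<union> ?a B) \<le> card (?a (A \<union> B))"
    by (rule card_mono[OF fin(3)]) blast
  finally show ?thesis by simp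
qed

text \<open>The sets \<open>X u\<close> are merged one at a time along a growing connected
  \<open>S\<close>. Each merge loses at most the arcs of the overlap, and the overlap sizes add up
  to the sum of the sizes minus the size of the union.\<close>

lemma sum_induced_arcs_le_of_connected:
  fixes X :: "'a \<Rightarrow> 'b set" and c :: real
  assumes K: "pair_graph K" "connected_part K (pverts K)"
    and fin: "\<And>u. u \<in> pverts K \<Longrightarrow> finite (X u)"
    and overlap: "\<And>S w. connected_part K S \<Longrightarrow> w \<in> pverts K - S \<Longrightarrow>
      real (card (R \<inter> (\<Union>(X ` S) \<inter> X w) \<times> (\<Union>(X ` S) \<inter> X w)))
        \<le> c * real (card (\<Union>(X ` S) \<inter> X w))"
  shows "(\<Sum>u\<in>pverts K. real (card (R \<inter> X u \<times> X u)))
    \<le> real (card (R \<inter> \<Union>(X ` pverts K) \<times> \<Union>(X ` pverts K)))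
      + c * ((\<Sum>u\<in>pverts K. real (card (X u))) - real (card (\<Union>(X ` pverts K))))"
  using K
proof (induct rule: connected_part_induct)
  case (insert S w)
  let ?U = "\<Union>(X ` S)" and ?a = "\<lambda>Y. real (card (R \<inter> Y \<times> Y))"
  have S: "S \<subseteq> pverts K" "finite S"
    using insert(1) pair_graph_finite[OF K(1)] finite_subset by (auto simp: connected_part_def)
  have finU: "finite ?U" "finite (X w)" using S fin insert(2) by auto
  have "?a ?U + ?a (X w) \<le> ?a (?U \<union> X w) + ?a (?U \<inter> X w)"
    using card_induced_supermodular[OF finU, of R] by (simp flip: of_nat_add)
  \<comment> \<open>The overlap size is expressed exactly by inclusion-exclusion, which makes the
    sum telescope and works for negative \<open>c\<close> as well.\<close>
  moreover have "real (card ?U) + real (card (X w))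
      = real (card (?U \<union> X w)) + real (card (?U \<inter> X w))"
    using card_Un_Int[OF finU] by (simp flip: of_nat_add)
  then have "c * real (card (?U \<inter> X w))
      = c * (real (card ?U) + real (card (X w)) - real (card (?U \<union> X w)))"
    by simp
  moreover have "\<Union>(X ` insert w S) = ?U \<union> X w" by auto
  ultimately show ?case
    using insert(2,3) overlap[OF insert(1,2)] S by (simp add: algebra_simps)
qed simp

section \<open>Shattering\<close>

definition shatters :: "nat \<Rightarrow> (nat \<Rightarrow> 'a set pair_pre_digraph) \<Rightarrow> (nat \<Rightarrow> 'a) set \<Rightarrow> bool" where
  "shatters m Ms V \<longleftrightarrow>
     (\<forall>P\<in>(\<Pi>\<^sub>E i\<in>{..<m}. pverts (Ms i)). (\<Pi>\<^sub>E i\<in>{..<m}. P i) \<inter> V \<noteq> {})"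

lemma shattered_by_iff: "shattered_by m Ms G \<longleftrightarrow> shatters m Ms (pverts G)"
  by (simp add: shattered_by_def shatters_def cart_prod_def)

text \<open>
  The strict bound lets \<open>d = 0\<close> express that \<open>V\<close> is empty, which is what overlaps of slices
  satisfy when \<open>V\<close> has dimension \<open>0\<close>.
\<close>

definition vcd_less :: "nat \<Rightarrow> (nat \<Rightarrow> 'a pair_pre_digraph) \<Rightarrow> (nat \<Rightarrow> 'a) set \<Rightarrow> nat \<Rightarrow> bool" where
  "vcd_less m Gs V d \<longleftrightarrow>
     (\<forall>Ms. minor_subproduct m Gs Ms \<and> shatters m Ms V \<longrightarrow> card (nontrivial_factors m Ms) < d)"

text \<open>With one part per factor the only box is the whole product, which meets every non-empty
  \<open>V\<close>.\<close>

lemma ex_shattered: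
  assumes G: "\<And>i. i < m \<Longrightarrow> pair_graph (Gs i)"
      "\<And>i. i < m \<Longrightarrow> connected_part (Gs i) (pverts (Gs i))"
    and V: "V \<subseteq> (\<Pi>\<^sub>E i\<in>{..<m}. pverts (Gs i))" "V \<noteq> {}"
  shows "\<exists>Ms. minor_subproduct m Gs Ms \<and> shatters m Ms V"
proof (intro exI conjI)
  let ?Ms = "\<lambda>i. \<lparr>pverts = {pverts (Gs i)}, parcs = {}\<rparr>"
  show "minor_subproduct m Gs ?Ms"
    unfolding minor_subproduct_def
  proof (intro allI impI conjI)
    fix i assume i: "i < m"
    show "pair_graph (?Ms i)" by (rule pair_graphI) auto
    show "partition_on (pverts (Gs i)) (pverts (?Ms i))"
      using G(2)[OF i] by (auto simp: partition_on_def connected_part_iff_cut[OF G(1)[OF i]])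
  qed (use G in auto)
  show "shatters m ?Ms V"
    unfolding shatters_def
  proof
    fix P assume P: "P \<in> (\<Pi>\<^sub>E i\<in>{..<m}. pverts (?Ms i))"
    have "(\<Pi>\<^sub>E i\<in>{..<m}. P i) = (\<Pi>\<^sub>E i\<in>{..<m}. pverts (Gs i))"
      using P by (intro PiE_cong) (auto dest: PiE_mem)
    then show "(\<Pi>\<^sub>E i\<in>{..<m}. P i) \<inter> V \<noteq> {}" using V by blast
  qed
qed

lemma vcd_less_0:
  assumes "\<And>i. i < m \<Longrightarrow> pair_graph (Gs i)"
    "\<And>i. i < m \<Longrightarrow> connected_part (Gs i) (pverts (Gs i))"
    "V \<subseteq> (\<Pi>\<^sub>E i\<in>{..<m}. pverts (Gs i))" "vcd_less m Gs V 0"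
  shows "V = {}"
  using ex_shattered[OF assms(1-3)] assms(4) by (auto simp: vcd_less_def)

lemma card_nontrivial_factors_Suc:
  "card (nontrivial_factors (Suc m) Ms)
    = card (nontrivial_factors m Ms) + (if 2 \<le> card (pverts (Ms m)) then 1 else 0)"
proof -
  have "nontrivial_factors (Suc m) Ms
      = nontrivial_factors m Ms \<union> (if 2 \<le> card (pverts (Ms m)) then {m} else {})"
    by (auto simp: nontrivial_factors_def less_Suc_eq)
  moreover have "finite (nontrivial_factors m Ms)" "m \<notin> nontrivial_factors m Ms"
    by (auto simp: nontrivial_factors_def)
  ultimately show ?thesis by simp
qed

lemma nontrivial_factors_upd: "nontrivial_factors m (Ms(m := N)) = nontrivial_factors m Ms"
  by (auto simp: nontrivial_factors_def)

text \<open>The new factor is taken edgeless: shattering and the count of non-trivial factors look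
  only at the parts.\<close>

lemma minor_subproduct_upd:
  assumes "minor_subproduct m Gs Ms" "partition_on (pverts (Gs m)) Q" "finite Q"
    "\<And>A. A \<in> Q \<Longrightarrow> connected_part (Gs m) A"
  shows "minor_subproduct (Suc m) Gs (Ms(m := \<lparr>pverts = Q, parcs = {}\<rparr>))"
proof -
  have "pair_graph \<lparr>pverts = Q, parcs = {}\<rparr>"
    by (rule pair_graphI) (use assms(3) in auto)
  then show ?thesis
    using assms by (auto simp: minor_subproduct_def less_Suc_eq)
qed

text \<open>The set in the hypothesis is the union of the slices of \<open>V\<close> over
  \<open>A\<close>. A vertex of it in a box of the first \<open>m\<close> factors is completed by
  some \<open>u\<close> in \<open>A\<close> to a vertex of \<open>V\<close> in the extended
  box.\<close>

lemma shatters_upd: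
  assumes "\<And>A. A \<in> Q \<Longrightarrow> shatters m Ms {x \<in> (\<Pi>\<^sub>E i\<in>{..<m}. UNIV). \<exists>u\<in>A. x(m := u) \<in> V}"
  shows "shatters (Suc m) (Ms(m := \<lparr>pverts = Q, parcs = {}\<rparr>)) V"
  unfolding shatters_def
proof
  fix P assume P: "P \<in> (\<Pi>\<^sub>E i\<in>{..<Suc m}. pverts ((Ms(m := \<lparr>pverts = Q, parcs = {}\<rparr>)) i))"
  have mem: "P i \<in> pverts (if i = m then \<lparr>pverts = Q, parcs = {}\<rparr> else Ms i)" if "i < Suc m" for i
    using PiE_mem[OF P, of i] that by simp
  let ?P = "restrict P {..<m}"
  have "?P \<in> (\<Pi>\<^sub>E i\<in>{..<m}. pverts (Ms i))"
  proof (rule PiE_I)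
    show "?P i \<in> pverts (Ms i)" if "i \<in> {..<m}" for i
      using mem[of i] that by simp
  qed simp
  moreover have "P m \<in> Q" using mem[of m] by simp
  ultimately obtain x u where x: "x \<in> (\<Pi>\<^sub>E i\<in>{..<m}. ?P i)" "u \<in> P m" "x(m := u) \<in> V"
    using assms[of "P m"] unfolding shatters_def by blast
  then have "x(m := u) \<in> (\<Pi>\<^sub>E i\<in>{..<Suc m}. P i)"
    by (force simp: PiE_iff extensional_def less_Suc_eq)
  then show "(\<Pi>\<^sub>E i\<in>{..<Suc m}. P i) \<inter> V \<noteq> {}" using x(3) by blast
qed

lemma shatters_mono: "shatters m Ms V \<Longrightarrow> V \<subseteq> W \<Longrightarrow> shatters m Ms W"
  unfolding shatters_def by blast

text \<open>The boxes are pairwise disjoint, so choosing a point of \<open>V\<close> in each is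
  injective; their number is the product of the numbers of parts.\<close>

lemma two_power_le_of_shatters:
  assumes Ms: "minor_subproduct m Gs Ms" and ne: "\<And>i. i < m \<Longrightarrow> pverts (Gs i) \<noteq> {}"
    and V: "shatters m Ms V" "finite V"
  shows "2 ^ card (nontrivial_factors m Ms) \<le> card V"
proof -
  let ?I = "{..<m}" and ?N = "nontrivial_factors m Ms"
  let ?\<Pi> = "\<Pi>\<^sub>E i\<in>?I. pverts (Ms i)"
  have part: "partition_on (pverts (Gs i)) (pverts (Ms i))" and
    fin: "finite (pverts (Ms i))" if "i < m" for i
    using Ms that pair_graph_finite(1) by (auto simp: minor_subproduct_def)
  \<comment> \<open>Non-empty factors have at least one part, so trivial factors do not shrink the
    product.\<close>
  have pos: "1 \<le> card (pverts (Ms i))" if "i < m" for i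
    using part[OF that] fin[OF that] ne[OF that]
    by (auto simp: partition_on_def Suc_le_eq card_gt_0_iff)
  have "(2::nat) ^ card ?N = (\<Prod>i\<in>?I. if i \<in> ?N then 2 else 1)"
    by (simp add: prod.If_cases nontrivial_factors_def Int_def)
  also have "\<dots> \<le> (\<Prod>i\<in>?I. card (pverts (Ms i)))"
    using pos by (intro prod_mono) (auto simp: nontrivial_factors_def)
  also have "\<dots> = card ?\<Pi>" by (simp add: card_PiE)
  also have "\<dots> \<le> card V"
  proof -
    have "\<forall>P\<in>?\<Pi>. \<exists>x. x \<in> (\<Pi>\<^sub>E i\<in>?I. P i) \<inter> V"
      using V(1) unfolding shatters_def by blast
    from bchoice[OF this] obtain f where f: "\<And>P. P \<in> ?\<Pi> \<Longrightarrow> f P \<in> (\<Pi>\<^sub>E i\<in>?I. P i) \<inter> V"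
      by blast
    have "inj_on f ?\<Pi>"
    proof (rule inj_onI)
      fix P Q assume PQ: "P \<in> ?\<Pi>" "Q \<in> ?\<Pi>" "f P = f Q"
      show "P = Q"
      proof (rule PiE_ext[OF PQ(1,2)])
        fix i assume i: "i \<in> ?I"
        have "f P i \<in> P i \<inter> Q i"
          using f[OF PQ(1)] f[OF PQ(2)] PQ(3) i by (auto dest: PiE_mem)
        moreover have "P i \<in> pverts (Ms i)" "Q i \<in> pverts (Ms i)"
          using PQ i by (auto dest: PiE_mem)
        ultimately show "P i = Q i"
          using part[of i] i by (auto simp: partition_on_def dest: disjointD)
      qed
    qed
    then show ?thesis using f V(2) by (intro card_inj_on_le) auto
  qed
  finally show ?thesis .
qed

section \<open>Induction on the number of factors\<close>

text \<open>Coordinate \<open>m\<close> is dropped, so slices at different values lie in one common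
  product and can overlap.\<close>

definition slice :: "nat \<Rightarrow> (nat \<Rightarrow> 'a) set \<Rightarrow> 'a \<Rightarrow> (nat \<Rightarrow> 'a) set" where
  "slice m V u = {x \<in> (\<Pi>\<^sub>E i\<in>{..<m}. UNIV). x(m := u) \<in> V}"

definition fibre :: "nat \<Rightarrow> (nat \<Rightarrow> 'a) set \<Rightarrow> (nat \<Rightarrow> 'a) \<Rightarrow> 'a set" where
  "fibre m V z = {u. z(m := u) \<in> V}"

lemma slice_mem: "x \<in> slice m V u \<Longrightarrow> x(m := u) \<in> V"
  by (simp add: slice_def)

lemma PiE_lessThan_SucD:
  assumes x: "x \<in> (\<Pi>\<^sub>E i\<in>{..<Suc m}. A i)"
  shows "x(m := undefined) \<in> (\<Pi>\<^sub>E i\<in>{..<m}. A i)" "x m \<in> A m"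
proof -
  show "x(m := undefined) \<in> (\<Pi>\<^sub>E i\<in>{..<m}. A i)"
  proof (rule PiE_I)
    show "(x(m := undefined)) i \<in> A i" if "i \<in> {..<m}" for i
      using PiE_mem[OF x, of i] that by simp
    show "(x(m := undefined)) i = undefined" if "i \<notin> {..<m}" for i
      using PiE_arb[OF x, of i] that by (cases "i = m") simp_all
  qed
  show "x m \<in> A m" using PiE_mem[OF x, of m] by simp
qed

lemma slice_subset:
  assumes V: "V \<subseteq> (\<Pi>\<^sub>E i\<in>{..<Suc m}. A i)"
  shows "slice m V u \<subseteq> (\<Pi>\<^sub>E i\<in>{..<m}. A i)"
proof
  fix x assume x: "x \<in> slice m V u"
  have upd: "x(m := u) \<in> (\<Pi>\<^sub>E i\<in>{..<Suc m}. A i)" by (rule subsetD[OF V slice_mem[OF x]])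
  have "x i \<in> A i" if "i < m" for i using PiE_mem[OF upd, of i] that by simp
  moreover have "x \<in> extensional {..<m}" using x by (simp add: slice_def PiE_iff)
  ultimately show "x \<in> (\<Pi>\<^sub>E i\<in>{..<m}. A i)" by (simp add: PiE_iff)
qed

lemma card_eq_sum_slices:
  assumes V: "V \<subseteq> (\<Pi>\<^sub>E i\<in>{..<Suc m}. A i)" and fin: "finite V" "finite (A m)"
  shows "card V = (\<Sum>u\<in>A m. card (slice m V u))"
    and "card V = (\<Sum>z\<in>(\<Union>u\<in>A m. slice m V u). card (fibre m V z))"
proof -
  let ?U = "\<Union>u\<in>A m. slice m V u"
  \<comment> \<open>Resetting coordinate \<open>m\<close> to \<open>undefined\<close>, the value of
    extensional functions off their domain, is the projection that forgets it.\<close>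
  have split: "x(m := undefined) \<in> slice m V (x m)" "x m \<in> A m" if "x \<in> V" for x
    using PiE_lessThan_SucD[of x m A] V that by (auto simp: slice_def PiE_iff)
  have ext: "z(m := undefined) = z" if "z \<in> slice m V u" for z u
    using that by (auto simp: slice_def PiE_iff extensional_def)
  have slice_eq: "slice m V u = (\<lambda>x. x(m := undefined)) ` {x \<in> V. x m = u}" for u
  proof (intro set_eqI iffI)
    fix z assume z: "z \<in> slice m V u"
    then have "z = (z(m := u))(m := undefined)" using ext by simp
    moreover have "z(m := u) \<in> {x \<in> V. x m = u}" using slice_mem[OF z] by simp
    ultimately show "z \<in> (\<lambda>x. x(m := undefined)) ` {x \<in> V. x m = u}" by (rule image_eqI)
  qed (use split in auto)
  have "inj_on (\<lambda>x. x(m := undefined)) {x \<in> V. x m = u}" for u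
    by (rule inj_onI) (metis (mono_tags) fun_upd_triv fun_upd_upd mem_Collect_eq)
  then have "card (slice m V u) = card {x \<in> V. x m = u}" for u
    by (simp add: slice_eq card_image)
  moreover have "card V = (\<Sum>u\<in>A m. card {x \<in> V. x m = u})"
    using split(2) sum.group[OF fin, of "\<lambda>x. x m" "\<lambda>_. 1::nat"] by (simp add: image_subset_iff)
  ultimately show "card V = (\<Sum>u\<in>A m. card (slice m V u))" by simp
  have finU: "finite ?U" using fin by (auto simp: slice_eq)
  have "card {x \<in> V. x(m := undefined) = z} = card (fibre m V z)" if "z \<in> ?U" for z
  proof -
    have "bij_betw (\<lambda>x. x m) {x \<in> V. x(m := undefined) = z} (fibre m V z)"
    proof (rule bij_betw_byWitness[where f' = "\<lambda>u. z(m := u)"])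
      show "(\<lambda>u. z(m := u)) ` fibre m V z \<subseteq> {x \<in> V. x(m := undefined) = z}"
        using that ext by (auto simp: fibre_def)
    qed (auto simp: fibre_def)
    then show ?thesis by (rule bij_betw_same_card)
  qed
  moreover have "card V = (\<Sum>z\<in>?U. card {x \<in> V. x(m := undefined) = z})"
  proof -
    have "(\<lambda>x. x(m := undefined)) ` V \<subseteq> ?U" using split by blast
    from sum.group[OF fin(1) finU this, of "\<lambda>_. 1::nat"] show ?thesis by simp
  qed
  ultimately show "card V = (\<Sum>z\<in>?U. card (fibre m V z))" by simp
qed

text \<open>An arc of the product changes exactly one coordinate. If it is the last, both ends have
  the same projection and the arc lies in a fibre; otherwise both ends share the last coordinate and
  the arc lies in a slice.\<close>

lemma card_induced_arcs_le_slices: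
  fixes Gs :: "nat \<Rightarrow> 'a pair_pre_digraph"
  assumes G: "pair_graph (Gs m)"
    and V: "V \<subseteq> (\<Pi>\<^sub>E i\<in>{..<Suc m}. pverts (Gs i))" "finite V"
  defines "U \<equiv> \<Union>u\<in>pverts (Gs m). slice m V u"
  shows "card (parcs (cart_prod (Suc m) Gs) \<inter> V \<times> V)
    \<le> (\<Sum>u\<in>pverts (Gs m). card (parcs (cart_prod m Gs) \<inter> slice m V u \<times> slice m V u))
      + (\<Sum>z\<in>U. card (parcs (Gs m) \<inter> fibre m V z \<times> fibre m V z))"
proof -
  let ?E = "parcs (cart_prod m Gs)" and ?X = "slice m V"
  \<comment> \<open>\<open>?A\<close> collects the arcs in the first \<open>m\<close> directions,
    slice by slice; \<open>?B\<close> those in the last direction, fibre by fibre.\<close>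
  let ?A = "\<Union>u\<in>pverts (Gs m). (\<lambda>(x, y). (x(m := u), y(m := u))) ` (?E \<inter> ?X u \<times> ?X u)"
  let ?B = "\<Union>z\<in>U. (\<lambda>(u, v). (z(m := u), z(m := v))) `
    (parcs (Gs m) \<inter> fibre m V z \<times> fibre m V z)"
  have finG: "finite (pverts (Gs m))" "finite (parcs (Gs m))"
    by (rule pair_graph_finite[OF G])+
  have slice_eq: "?X u \<subseteq> (\<lambda>x. x(m := undefined)) ` V" for u
  proof
    fix z assume z: "z \<in> ?X u"
    then have "z = (z(m := u))(m := undefined)"
      by (auto simp: slice_def PiE_iff extensional_def)
    then show "z \<in> (\<lambda>x. x(m := undefined)) ` V" using slice_mem[OF z] by (rule image_eqI)
  qed
  have finX: "finite (?X u)" for u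
    using slice_eq V(2) by (rule finite_subset[OF _ finite_imageI])
  have finU: "finite U" using finX finG by (simp add: U_def)
  have sub: "parcs (cart_prod (Suc m) Gs) \<inter> V \<times> V \<subseteq> ?A \<union> ?B"
  proof
    fix a assume a: "a \<in> parcs (cart_prod (Suc m) Gs) \<inter> V \<times> V"
    obtain x y where xy: "a = (x, y)" by fastforce
    let ?x = "x(m := undefined)" and ?y = "y(m := undefined)"
    have mem: "x \<in> V" "y \<in> V" using a xy by auto
    then have "x \<in> (\<Pi>\<^sub>E i\<in>{..<Suc m}. pverts (Gs i))" "y \<in> (\<Pi>\<^sub>E i\<in>{..<Suc m}. pverts (Gs i))"
      using V(1) by auto
    note x = PiE_lessThan_SucD[OF this(1)] and y = PiE_lessThan_SucD[OF this(2)]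
    have sl: "?x \<in> ?X (x m)" "?y \<in> ?X (y m)"
      using x y mem by (auto simp: slice_def PiE_iff)
    obtain j where j: "j < Suc m" "x j \<noteq> y j" "(x j, y j) \<in> parcs (Gs j)"
      "\<And>i. i < Suc m \<Longrightarrow> i \<noteq> j \<Longrightarrow> x i = y i"
      using a xy by (auto simp: cart_prod_def)
    show "a \<in> ?A \<union> ?B"
    proof (cases "j = m")
      case True
      have "?x = ?y"
      proof
        fix i show "?x i = ?y i"
          using j(4)[of i] True x(1) y(1) by (cases "i < m") (auto simp: PiE_iff extensional_def)
      qed
      then have "y = ?x(m := y m)" "x = ?x(m := x m)" by (metis fun_upd_triv fun_upd_upd)+
      then have "a = (\<lambda>(u, v). (?x(m := u), ?x(m := v))) (x m, y m)" "y m \<in> fibre m V ?x"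
        "x m \<in> fibre m V ?x"
        using xy mem by (auto simp: fibre_def)
      moreover have "?x \<in> U" using sl x(2) by (auto simp: U_def)
      ultimately have "a \<in> ?B" using j(3) True by blast
      then show ?thesis by blast
    next
      case False
      then have eq: "x m = y m" using j(4)[of m] by simp
      have "(?x, ?y) \<in> ?E"
        unfolding cart_prod_def using x(1) y(1) j False
        by (auto intro!: exI[of _ j])
      moreover have "a = (\<lambda>(p, q). (p(m := x m), q(m := x m))) (?x, ?y)"
        using xy by (simp add: fun_upd_idem eq)
      ultimately have "a \<in> (\<lambda>(p, q). (p(m := x m), q(m := x m))) ` (?E \<inter> ?X (x m) \<times> ?X (x m))"
        using sl eq by (intro image_eqI) auto
      then have "a \<in> ?A" using x(2) by (rule UN_I[rotated])
      then show ?thesis by blast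
    qed
  qed
  have fin: "finite ?A" "finite ?B" using finG finX finU by auto
  have "card (parcs (cart_prod (Suc m) Gs) \<inter> V \<times> V) \<le> card (?A \<union> ?B)"
    using sub fin by (intro card_mono) auto
  also have "\<dots> \<le> card ?A + card ?B" by (rule card_Un_le)
  also have "card ?A \<le> (\<Sum>u\<in>pverts (Gs m). card (?E \<inter> ?X u \<times> ?X u))"
    using finG finX by (intro order.trans[OF card_UN_le] sum_mono card_image_le) auto
  also have "card ?B \<le> (\<Sum>z\<in>U. card (parcs (Gs m) \<inter> fibre m V z \<times> fibre m V z))"
    using finG finU by (intro order.trans[OF card_UN_le] sum_mono card_image_le) auto
  finally show ?thesis by simp
qed

text \<open>Contracting the last factor to a single part turns anything shattered by the projection
  into something shattered by \<open>V\<close> with equally many non-trivial factors.\<close>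

lemma vcd_less_projection:
  assumes G: "pair_graph (Gs m)" "connected_part (Gs m) (pverts (Gs m))"
    and V: "vcd_less (Suc m) Gs V d"
  shows "vcd_less m Gs (\<Union>u\<in>pverts (Gs m). slice m V u) d"
  unfolding vcd_less_def
proof (intro allI impI)
  fix Ms assume Ms: "minor_subproduct m Gs Ms \<and> shatters m Ms (\<Union>u\<in>pverts (Gs m). slice m V u)"
  let ?Q = "{pverts (Gs m)}"
  let ?N = "Ms(m := \<lparr>pverts = ?Q, parcs = {}\<rparr>)"
  have "minor_subproduct (Suc m) Gs ?N"
    using Ms G by (intro minor_subproduct_upd)
      (auto simp: partition_on_def connected_part_iff_cut[OF G(1)])
  moreover have "shatters (Suc m) ?N V"
    using Ms by (intro shatters_upd) (auto simp: slice_def elim!: shatters_mono)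
  ultimately have "card (nontrivial_factors (Suc m) ?N) < d"
    using V by (auto simp: vcd_less_def)
  then show "card (nontrivial_factors m Ms) < d"
    by (simp add: card_nontrivial_factors_Suc nontrivial_factors_upd)
qed

text \<open>A point of the overlap extends into \<open>V\<close> both by a value in \<open>S\<close>
  and by \<open>w\<close>, hence by values in both parts of a bipartition separating them. That
  bipartition is one more non-trivial factor.\<close>

lemma vcd_less_overlap:
  assumes G: "pair_graph (Gs m)" "connected_part (Gs m) (pverts (Gs m))"
    and S: "connected_part (Gs m) S" "w \<in> pverts (Gs m) - S"
    and V: "vcd_less (Suc m) Gs V (Suc d)"
  shows "vcd_less m Gs (\<Union>(slice m V ` S) \<inter> slice m V w) d"
  unfolding vcd_less_def
proof (intro allI impI)
  fix Ms assume Ms: "minor_subproduct m Gs Ms \<and>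
    shatters m Ms (\<Union>(slice m V ` S) \<inter> slice m V w)"
  obtain A B where AB: "connected_part (Gs m) A" "connected_part (Gs m) B" "S \<subseteq> A" "{w} \<subseteq> B"
    "A \<inter> B = {}" "A \<union> B = pverts (Gs m)"
    using connected_bipartition[OF G S(1) connected_part_singleton[OF G(1)]] S(2) by blast
  let ?N = "Ms(m := \<lparr>pverts = {A, B}, parcs = {}\<rparr>)"
  have ne: "A \<noteq> {}" "B \<noteq> {}" using AB by (auto simp: connected_part_iff_cut[OF G(1)])
  then have "A \<noteq> B" using AB(5) by blast
  have "minor_subproduct (Suc m) Gs ?N"
    using Ms AB ne by (intro minor_subproduct_upd) (auto simp: partition_on_def disjoint_def)
  moreover have "shatters (Suc m) ?N V"
  proof (rule shatters_upd)
    fix C assume "C \<in> {A, B}"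
    then show "shatters m Ms {x \<in> (\<Pi>\<^sub>E i\<in>{..<m}. UNIV). \<exists>u\<in>C. x(m := u) \<in> V}"
      using AB(3,4) by (intro shatters_mono[OF conjunct2[OF Ms]]) (auto simp: slice_def)
  qed
  ultimately have "card (nontrivial_factors (Suc m) ?N) < Suc d"
    using V by (auto simp: vcd_less_def)
  then show "card (nontrivial_factors m Ms) < d"
    using \<open>A \<noteq> B\<close> by (simp add: card_nontrivial_factors_Suc nontrivial_factors_upd)
qed

text \<open>Since \<open>d\<close> is a strict bound, \<open>d - 1\<close> bounds the dimension; the
  subtraction is real, and for \<open>d = 0\<close> the set \<open>V\<close> is empty.
  \<open>V\<close> and \<open>d\<close> vary in the induction, which is applied to the projection
  with \<open>d\<close> and to overlaps with the predecessor of \<open>d\<close>.\<close>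

lemma induced_arcs_le_of_vcd_less:
  fixes Gs :: "nat \<Rightarrow> 'a pair_pre_digraph"
  assumes bound: "bounds_avg_degree H \<mu>" and \<mu>: "0 \<le> \<mu>"
    and "\<And>i. i < m \<Longrightarrow> pair_graph (Gs i)"
      "\<And>i. i < m \<Longrightarrow> connected_part (Gs i) (pverts (Gs i))"
      "\<And>i. i < m \<Longrightarrow> \<not> is_minor H (Gs i)"
    and "V \<subseteq> (\<Pi>\<^sub>E i\<in>{..<m}. pverts (Gs i))" "vcd_less m Gs V d"
  shows "real (card (parcs (cart_prod m Gs) \<inter> V \<times> V)) \<le> 2 * \<mu> * (real d - 1) * real (card V)"
  using assms(3-)
proof (induct m arbitrary: V d)
  case 0
  show ?case
  proof (cases d)
    case 0
    then have "V = {}" using vcd_less_0[of 0 Gs V] "0.prems" by simp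
    then show ?thesis by simp
  qed (use \<mu> in \<open>simp add: cart_prod_def\<close>)
next
  case (Suc m)
  show ?case
  proof (cases d)
    case 0
    then have "V = {}" using vcd_less_0[of "Suc m" Gs V] Suc.prems by simp
    then show ?thesis by simp
  next
    case (Suc d')
    let ?K = "Gs m" and ?X = "slice m V" and ?E = "parcs (cart_prod m Gs)"
    let ?U = "\<Union>u\<in>pverts ?K. ?X u"
    let ?a = "\<lambda>Y. real (card (?E \<inter> Y \<times> Y))"
    have K: "pair_graph ?K" "connected_part ?K (pverts ?K)" "\<not> is_minor H ?K"
      using Suc.prems by auto
    have finP: "finite (\<Pi>\<^sub>E i\<in>{..<n}. pverts (Gs i))" if "n \<le> Suc m" for n
      using that by (intro finite_PiE pair_graph_finite(1) Suc.prems(1)) auto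
    have finV: "finite V" using Suc.prems(4) finP[of "Suc m"] finite_subset by auto
    have subX: "?X u \<subseteq> (\<Pi>\<^sub>E i\<in>{..<m}. pverts (Gs i))" for u
      by (rule slice_subset[OF Suc.prems(4)])
    have finX: "finite (?X u)" for u using finite_subset[OF subX finP[of m]] by simp
    note IH = Suc.hyps[OF Suc.prems(1-3)]
    have overlap: "?a (\<Union>(?X ` S) \<inter> ?X w) \<le> 2 * \<mu> * (real d' - 1) * real (card (\<Union>(?X ` S) \<inter> ?X w))"
      if "connected_part ?K S" "w \<in> pverts ?K - S" for S w
    proof (rule IH)
      show "vcd_less m Gs (\<Union>(?X ` S) \<inter> ?X w) d'"
        using vcd_less_overlap[of Gs m S w V d', OF K(1,2) that] Suc.prems(5) Suc by simp
    qed (use subX in \<open>simp_all add: le_infI2\<close>)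
    have merged: "(\<Sum>u\<in>pverts ?K. ?a (?X u))
        \<le> ?a ?U + 2 * \<mu> * (real d' - 1) * ((\<Sum>u\<in>pverts ?K. real (card (?X u))) - real (card ?U))"
      by (rule sum_induced_arcs_le_of_connected[OF K(1,2) finX overlap])
    have proj: "?a ?U \<le> 2 * \<mu> * (real d - 1) * real (card ?U)"
      using subX vcd_less_projection[of Gs m V d] K Suc.prems(5) by (intro IH) auto
    \<comment> \<open>A fibre of size \<open>k\<close> has at most \<open>\<mu> * k\<close> arcs,
      which is at most \<open>2 * \<mu> * (k - 1)\<close> once \<open>k\<close> is at least 2; a
      single vertex has no arcs. The subtracted 1 yields, summed over the projection, the term
      \<open>- real (card ?U)\<close>.\<close>
    have fibres: "real (card (parcs ?K \<inter> fibre m V z \<times> fibre m V z))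
        \<le> 2 * \<mu> * (real (card (fibre m V z)) - 1)" if "z \<in> ?U" for z
    proof -
      let ?F = "fibre m V z"
      have F: "?F \<subseteq> pverts ?K"
      proof
        fix u assume "u \<in> ?F"
        then have "z(m := u) \<in> (\<Pi>\<^sub>E i\<in>{..<Suc m}. pverts (Gs i))"
          using Suc.prems(4) by (auto simp: fibre_def)
        then show "u \<in> pverts ?K" using PiE_lessThan_SucD(2) by fastforce
      qed
      have finF: "finite ?F" using F pair_graph_finite(1)[OF K(1)] finite_subset by blast
      have neF: "?F \<noteq> {}" using that by (auto simp: slice_def fibre_def)
      have deg: "real (card (parcs ?K \<inter> ?F \<times> ?F)) \<le> \<mu> * real (card ?F)"
        by (rule induced_arcs_le_of_minor_free[OF bound K(1,3) F])
      show ?thesis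
      proof (cases "card ?F = 1")
        case True
        then obtain v where "?F = {v}" by (auto simp: card_1_singleton_iff)
        then show ?thesis using pair_graph_irrefl[OF K(1)] by simp
      next
        case False
        then have two: "2 \<le> real (card ?F)"
          using neF finF by (cases "card ?F") (auto simp: card_gt_0_iff)
        then have "\<mu> * real (card ?F) \<le> \<mu> * (2 * (real (card ?F) - 1))"
          using \<mu> by (intro mult_left_mono) auto
        then show ?thesis using deg by (simp add: algebra_simps)
      qed
    qed
    note counts = card_eq_sum_slices[OF Suc.prems(4) finV pair_graph_finite(1)[OF K(1)]]
    have "(\<Sum>z\<in>?U. real (card (parcs ?K \<inter> fibre m V z \<times> fibre m V z)))
        \<le> (\<Sum>z\<in>?U. 2 * \<mu> * (real (card (fibre m V z)) - 1))"
      by (rule sum_mono[OF fibres])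
    also have "\<dots> = 2 * \<mu> * (real (card V) - real (card ?U))"
      by (subst counts(2)) (simp add: sum_subtractf flip: sum_distrib_left)
    finally have fib: "(\<Sum>z\<in>?U. real (card (parcs ?K \<inter> fibre m V z \<times> fibre m V z)))
        \<le> 2 * \<mu> * (real (card V) - real (card ?U))" .
    have "real (card (parcs (cart_prod (Suc m) Gs) \<inter> V \<times> V)) \<le> (\<Sum>u\<in>pverts ?K. ?a (?X u))
        + (\<Sum>z\<in>?U. real (card (parcs ?K \<inter> fibre m V z \<times> fibre m V z)))"
      using card_induced_arcs_le_slices[of Gs m V] K(1) Suc.prems(4) finV
      by (simp flip: of_nat_sum of_nat_add)
    moreover have "(\<Sum>u\<in>pverts ?K. real (card (?X u))) = real (card V)"
      using counts(1) by simp
    \<comment> \<open>In units of \<open>2 * \<mu>\<close>, the projection gives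
      \<open>d' * |U|\<close>, the overlaps \<open>(d' - 1) * (|V| - |U|)\<close> and the fibres
      \<open>|V| - |U|\<close>; the total is \<open>d' * |V|\<close>.\<close>
    ultimately show ?thesis using merged proj fib Suc by (simp add: algebra_simps)
  qed
qed

section \<open>Edge density against minor VC-dimension, and the logarithmic bound\<close>

theorem theorem4p2:
  fixes H :: "'h pair_pre_digraph"
    and \<mu> :: real
    and m :: nat
    and Gs :: "nat \<Rightarrow> 'a pair_pre_digraph"
    and G :: "(nat \<Rightarrow> 'a) pair_pre_digraph"
  assumes "pair_graph H"
    and "bounds_avg_degree H \<mu>"
    and "\<And>i. i < m \<Longrightarrow> pair_graph (Gs i)"
    and "\<And>i. i < m \<Longrightarrow> connected_graph (Gs i)"
    and "\<And>i. i < m \<Longrightarrow> \<not> is_minor H (Gs i)"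
    and "pair_graph G"
    and "subgraph (with_proj G) (with_proj (cart_prod m Gs))"
    and "pverts G \<noteq> {}"
  shows "real (card (uedges G)) / real (card (pverts G)) \<le> \<mu> * real (vcd_star m Gs G) \<and>
         \<mu> * real (vcd_star m Gs G) \<le> \<mu> * log 2 (real (card (pverts G)))"
proof -
  let ?V = "pverts G" and ?d = "vcd_star m Gs G"
  let ?D = "{card (nontrivial_factors m Ms) | Ms. minor_subproduct m Gs Ms \<and> shatters m Ms ?V}"
  have conn: "connected_part (Gs i) (pverts (Gs i))" if "i < m" for i
    using assms(3,4) connected_part_verts that by blast
  have V: "?V \<subseteq> (\<Pi>\<^sub>E i\<in>{..<m}. pverts (Gs i))"
    using assms(7) by (auto simp: subgraph_def cart_prod_def)
  have E: "parcs G \<subseteq> parcs (cart_prod m Gs) \<inter> ?V \<times> ?V"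
    using assms(7) pair_graph_in_verts[OF assms(6)] by (auto simp: subgraph_def)
  have finV: "finite ?V" "0 < card ?V"
    using assms(6,8) by (simp_all add: pair_graph_finite card_gt_0_iff)
  have D: "?d = Max ?D" by (simp add: vcd_star_def shattered_by_iff)
  have "card (nontrivial_factors m Ms) \<le> m" for Ms :: "nat \<Rightarrow> 'a set pair_pre_digraph"
    using card_mono[of "{..<m}" "nontrivial_factors m Ms"] by (auto simp: nontrivial_factors_def)
  then have "?D \<subseteq> {..m}" by auto
  then have finD: "finite ?D" using finite_subset by blast
  have "?D \<noteq> {}" using ex_shattered[OF assms(3) conn V assms(8)] by blast
  then have "?d \<in> ?D" unfolding D by (rule Max_in[OF finD])
  then obtain Ms where Ms: "minor_subproduct m Gs Ms" "shatters m Ms ?V"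
    "?d = card (nontrivial_factors m Ms)" by blast
  show ?thesis
  \<comment> \<open>Without factors there is no minor-free graph from which to infer the sign of
    \<open>\<mu>\<close>; but then \<open>G\<close> is a single vertex, its dimension is 0, and all
    three quantities vanish.\<close>
  proof (cases "m = 0")
    case True
    then have "?V = {\<lambda>_. undefined}" "parcs G = {}"
      using V E assms(8) by (auto simp: cart_prod_def)
    then show ?thesis using Ms(3) True by (simp add: nontrivial_factors_def uedges_def)
  next
    case False
    have ne: "pverts (Gs i) \<noteq> {}" if "i < m" for i
      using conn[OF that] connected_part_iff_cut[OF assms(3)[OF that]] by blast
    then obtain v where "v \<in> pverts (Gs 0)" using False by blast
    \<comment> \<open>A single vertex of the first factor induces no arcs, so the bound for it reads
      \<open>0 \<le> \<mu>\<close>.\<close>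
    then have \<mu>: "0 \<le> \<mu>"
      using induced_arcs_le_of_minor_free[OF assms(2) assms(3) assms(5), of 0 "{v}"] False by simp
    \<comment> \<open>The strict bound is one above the maximum, so the factor
      \<open>real (Suc ?d) - 1\<close> becomes \<open>real ?d\<close>.\<close>
    have "vcd_less m Gs ?V (Suc ?d)"
      unfolding vcd_less_def D using finD by (auto simp: less_Suc_eq_le intro!: Max_ge)
    from induced_arcs_le_of_vcd_less[OF assms(2) \<mu> assms(3) conn assms(5) V this]
    have "real (card (parcs (cart_prod m Gs) \<inter> ?V \<times> ?V)) \<le> 2 * \<mu> * real ?d * real (card ?V)"
      by simp
    moreover have "card (parcs G) \<le> card (parcs (cart_prod m Gs) \<inter> ?V \<times> ?V)"
      using E finV(1) by (intro card_mono) auto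
    \<comment> \<open>Passing from arcs to edges halves the count and cancels the factor 2.\<close>
    ultimately have "real (card (uedges G)) \<le> \<mu> * real ?d * real (card ?V)"
      using card_parcs_eq[OF assms(6)] by linarith
    then have "real (card (uedges G)) / real (card ?V) \<le> \<mu> * real ?d"
      using finV(2) by (simp add: divide_le_eq)
    moreover have "2 ^ ?d \<le> real (card ?V)"
      using two_power_le_of_shatters[OF Ms(1) ne Ms(2) finV(1)] Ms(3)
      by (metis of_nat_le_iff of_nat_numeral of_nat_power)
    then have "real ?d \<le> log 2 (real (card ?V))"
      using finV(2) by (simp add: le_log_iff powr_realpow)
    then have "\<mu> * real ?d \<le> \<mu> * log 2 (real (card ?V))" using \<mu> by (rule mult_left_mono)
    ultimately show ?thesis by blast
  qed
qed

end
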